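(* For every integer $n\ge 1$, the Mostar index of the Fibonacci cube $\Gamma_n$ is given by $$\mathrm{Mo}(\Gamma_n)=\sum_{k=1}^{n} f_{k}\,f_{n-k+1}\left(f_{k+1}f_{n-k+2}-f_{k}f_{n-k+1}\right).$$
   Context: Fibonacci numbers: $f_0=0$, $f_1=1$, $f_n=f_{n-1}+f_{n-2}$ for $n\ge 2$. Fibonacci cube: for $n\ge 1$, $\Gamma_n$ is the graph whose vertices are the binary strings $b_1b_2\ldots b_n\in\{0,1\}^n$ with $b_i\cdot b_{i+1}=0$ for all $1\le i\le n-1$ (no two consecutive 1s), two vertices being adjacent if and only if they differ in exactly one coordinate (i.e. the subgraph of the $n$-dimensional hypercube induced by these strings). Mostar index: for a graph $G$ and an edge $uv\in E(G)$, $n_u(G)$ is the number of vertices of $G$ that are strictly closer (in the shortest path metric of $G$) to $u$ than to $v$, and $n_v(G)$ is the number of vertices strictly closer to $v$ than to $u$. The Mostar index is $\mathrm{Mo}(G)=\sum_{uv\in E(G)}|n_u(G)-n_v(G)|$, the sum being over (unordered) edges. *)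

theory Defs
  imports
    "HOL-Number_Theory.Fib"
    "Graph_Theory.Pair_Digraph"
    "Graph_Theory.Shortest_Path"
begin

text \<open>
  Finite simple graphs are symmetric loop-free digraphs (locale \<open>pair_graph\<close>): an undirected
  edge \<open>uv\<close> corresponds to the two arcs \<open>(u, v)\<close> and \<open>(v, u)\<close>.
\<close>

context pair_graph
begin

text \<open>
  Every arc has length 1, so that this is the usual shortest path metric
  (infinite between different components).
\<close>

definition distance :: "'a \<Rightarrow> 'a \<Rightarrow> ereal" where
  "distance u v = \<mu> (\<lambda>_. 1) u v"

text \<open>\<open>closer u v\<close> is the number $n_u$ for the edge $uv$, and \<open>closer v u\<close> is $n_v$.\<close>

definition closer :: "'a \<Rightarrow> 'a \<Rightarrow> nat" where
  "closer u v = card {w \<in> pverts G. distance w u < distance w v}"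

definition edges :: "'a set set" where
  "edges = {{u, v} |u v. (u, v) \<in> parcs G}"

definition edge_imbalance :: "'a set \<Rightarrow> int" where
  "edge_imbalance e =
    (THE m. \<exists>u v. e = {u, v} \<and> m = \<bar>int (closer u v) - int (closer v u)\<bar>)"

text \<open>The description is proper, as the value does not depend on the order of the end points.\<close>

lemma edge_imbalance_pair:
  "edge_imbalance {u, v} = \<bar>int (closer u v) - int (closer v u)\<bar>"
  unfolding edge_imbalance_def
  by (rule the_equality) (auto simp: doubleton_eq_iff)

definition Mostar :: int where
  "Mostar = (\<Sum>e\<in>edges. edge_imbalance e)"

end

definition fibonacci_strings :: "nat \<Rightarrow> bool list set" where
  "fibonacci_strings n =
    {b. length b = n \<and> (\<forall>i. Suc i < n \<longrightarrow> \<not> (b ! i \<and> b ! Suc i))}"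

definition fibonacci_cube :: "nat \<Rightarrow> bool list pair_pre_digraph" where
  "fibonacci_cube n =
    \<lparr> pverts = fibonacci_strings n,
      parcs = {(b, c). b \<in> fibonacci_strings n \<and> c \<in> fibonacci_strings n \<and>
                       card {i. i < n \<and> b ! i \<noteq> c ! i} = 1} \<rparr>"

lemma finite_fibonacci_strings: "finite (fibonacci_strings n)"
proof (rule finite_subset)
  show "fibonacci_strings n \<subseteq> {b. set b \<subseteq> UNIV \<and> length b = n}"
    by (auto simp: fibonacci_strings_def)
  show "finite {b :: bool list. set b \<subseteq> UNIV \<and> length b = n}"
    by (rule finite_lists_length_eq) simp
qed

text \<open>
  The graph parameters above are thus meaningful for the Fibonacci cube.
\<close>

lemma pair_graph_fibonacci_cube: "pair_graph (fibonacci_cube n)"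
proof
  let ?V = "fibonacci_strings n" and ?G = "fibonacci_cube n"
  show "fst e \<in> pverts ?G" "snd e \<in> pverts ?G" "fst e \<noteq> snd e" if "e \<in> parcs ?G" for e
    using that by (auto simp: fibonacci_cube_def)
  show "finite (pverts ?G)"
    by (simp add: fibonacci_cube_def finite_fibonacci_strings)
  have "parcs ?G \<subseteq> ?V \<times> ?V"
    by (auto simp: fibonacci_cube_def)
  then show "finite (parcs ?G)"
    by (rule finite_subset) (simp add: finite_fibonacci_strings)
  have "{i. i < n \<and> b ! i \<noteq> c ! i} = {i. i < n \<and> c ! i \<noteq> b ! i}" for b c :: "bool list"
    by auto
  then show "symmetric ?G"
    by (simp add: symmetric_def sym_def fibonacci_cube_def)
qed

end

theory Submission
  imports Defs
begin

text \<open>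
  The Fibonacci cube is an isometric subgraph of the hypercube: its shortest path metric is the
  Hamming distance (\<open>distance_fibonacci_cube\<close>). Now take an edge whose end points differ at
  position \<open>i\<close>, say \<open>u\<close> has a 1 there and \<open>u'\<close> a 0. All other positions contribute equally to the
  distances of a string \<open>w\<close> to \<open>u\<close> and to \<open>u'\<close>, so \<open>w\<close> is closer to \<open>u\<close> if it has a 1 at
  position \<open>i\<close> and closer to \<open>u'\<close> otherwise. The contribution of the edge to the Mostar index
  therefore depends on \<open>i\<close> only: it is the number of strings with a 0 at position \<open>i\<close> minus the
  number of those with a 1 there (\<open>closer_fibonacci_cube\<close>).

  An edge in direction \<open>i\<close> is determined by its end point with a 1 at position \<open>i\<close>, and every
  string with a 1 there is such an end point, because replacing a 1 by a 0 never creates two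
  consecutive 1s. So there are as many edges in direction \<open>i\<close> as strings with a 1 at position \<open>i\<close>
  (\<open>bij_betw_edges_fibonacci_cube\<close>).

  It remains to count strings. A 0 at position \<open>i\<close> separates a string into two independent
  Fibonacci strings, and there are $f_{m+2}$ Fibonacci strings of length $m$; counting positions
  from 0, this makes $f_{i+2} f_{n-i+1}$ strings with a 0 at position \<open>i\<close>. By the addition formula
  for Fibonacci numbers, the other strings of length $n$ number $f_{i+1} f_{n-i}$. The sum over
  $k = i + 1$ is the claim.
\<close>

section \<open>Recognizing a distance function\<close>

text \<open>
  A potential \<open>h\<close> that vanishes at \<open>v\<close> is the distance to \<open>v\<close> if it drops by at most 1 along
  each arc (so no walk to \<open>v\<close> is shorter than \<open>h\<close>) and if from each vertex other than \<open>v\<close> some arc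
  makes it drop by 1 (so that greedy descent gives a walk of length \<open>h\<close>).
\<close>

lemma (in pair_graph) distance_eqI:
  fixes h :: "'a \<Rightarrow> nat"
  assumes x: "x \<in> pverts G" and v: "v \<in> pverts G" and "h v = 0"
    and arc: "\<And>x y. (x, y) \<in> parcs G \<Longrightarrow> h x \<le> Suc (h y)"
    and descent: "\<And>x. x \<in> pverts G \<Longrightarrow> x \<noteq> v \<Longrightarrow> \<exists>y. (x, y) \<in> parcs G \<and> h x = Suc (h y)"
  shows "distance x v = ereal (h x)"
proof (rule antisym)
  have "\<exists>p. awalk x p v \<and> awalk_cost (\<lambda>_. 1) p = h x"
    using x
  proof (induction "h x" arbitrary: x)
    case 0
    then have "x = v"
      using descent by fastforce
    then show ?case
      using v \<open>h v = 0\<close> by (intro exI[of _ "[]"]) (simp add: awalk_Nil_iff)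
  next
    case (Suc k)
    then have "x \<noteq> v"
      using \<open>h v = 0\<close> by auto
    then obtain y where y: "(x, y) \<in> parcs G" "h x = Suc (h y)"
      using descent Suc.prems by blast
    moreover obtain p where "awalk y p v" "awalk_cost (\<lambda>_. 1) p = h y"
      using Suc y arc_snd_in_verts[OF y(1)] by auto
    ultimately show ?case
      using Suc.prems by (intro exI[of _ "(x, y) # p"]) (simp add: awalk_Cons_iff)
  qed
  then show "distance x v \<le> ereal (h x)"
    unfolding distance_def by (metis min_cost_le_walk_cost)
next
  have "h x \<le> awalk_cost (\<lambda>_. 1) p" if "awalk x p v" for p x
    using that
  proof (induction p arbitrary: x)
    case Nil
    then show ?case
      using \<open>h v = 0\<close> by (simp add: awalk_Nil_iff)
  next
    case (Cons e p)
    then have "h (snd e) \<le> awalk_cost (\<lambda>_. 1) p" "(x, snd e) \<in> parcs G"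
      by (auto simp: awalk_Cons_iff)
    with arc[of x "snd e"] show ?case
      by simp
  qed
  then show "ereal (h x) \<le> distance x v"
    unfolding distance_def \<mu>_def by (intro INF_greatest) auto
qed

section \<open>The metric of the Fibonacci cube\<close>

definition hamming :: "nat \<Rightarrow> bool list \<Rightarrow> bool list \<Rightarrow> nat" where
  "hamming n b c = card {i. i < n \<and> b ! i \<noteq> c ! i}"

lemma hamming_commute: "hamming n b c = hamming n c b"
  unfolding hamming_def by (rule arg_cong[where f = card]) auto

lemma hamming_refl [simp]: "hamming n b b = 0"
  by (simp add: hamming_def)

lemma hamming_triangle: "hamming n b d \<le> hamming n b c + hamming n c d"
proof -
  have "hamming n b d \<le> card ({i. i < n \<and> b ! i \<noteq> c ! i} \<union> {i. i < n \<and> c ! i \<noteq> d ! i})"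
    unfolding hamming_def by (rule card_mono) auto
  also have "\<dots> \<le> hamming n b c + hamming n c d"
    unfolding hamming_def by (rule card_Un_le)
  finally show ?thesis .
qed

lemma hamming_fix_bit:
  assumes "i < n" "length b = n" "b ! i \<noteq> c ! i"
  shows "hamming n b c = Suc (hamming n (b[i := c ! i]) c)"
proof -
  have "{j. j < n \<and> b ! j \<noteq> c ! j} = insert i {j. j < n \<and> b[i := c ! i] ! j \<noteq> c ! j}"
    using assms by (auto simp: nth_list_update)
  then show ?thesis
    using assms by (simp add: hamming_def)
qed

lemma hamming_flip_bit:
  assumes "i < n" "length b = n" "x \<noteq> b ! i"
  shows "hamming n b (b[i := x]) = 1"
proof -
  have "{j. j < n \<and> b ! j \<noteq> b[i := x] ! j} = {i}"
    using assms by (auto simp: nth_list_update)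
  then show ?thesis
    by (simp add: hamming_def)
qed

lemma fibonacci_strings_mono:
  assumes "c \<in> fibonacci_strings n" "length b = n" "\<And>i. i < n \<Longrightarrow> b ! i \<Longrightarrow> c ! i"
  shows "b \<in> fibonacci_strings n"
  using assms by (auto simp: fibonacci_strings_def)

lemma clear_bit_fibonacci_strings:
  assumes "b \<in> fibonacci_strings n"
  shows "b[i := False] \<in> fibonacci_strings n"
proof (rule fibonacci_strings_mono[OF assms])
  have len: "length b = n"
    using assms by (simp add: fibonacci_strings_def)
  then show "length (b[i := False]) = n"
    by simp
  show "b ! j" if "j < n" "b[i := False] ! j" for j
    using that len by (cases "j = i") auto
qed

text \<open>
  This is where the embedding into the hypercube turns out to be isometric. If some 1 of \<open>b\<close> is
  a 0 of \<open>c\<close>, then it can be cleared. Otherwise all 1s of \<open>b\<close> are 1s of \<open>c\<close>, and then any missing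
  one can be set, since the result still has 1s only where \<open>c\<close> has.
\<close>

lemma fibonacci_strings_approach:
  assumes b: "b \<in> fibonacci_strings n" and c: "c \<in> fibonacci_strings n" and "b \<noteq> c"
  obtains i where "i < n" "b ! i \<noteq> c ! i" "b[i := c ! i] \<in> fibonacci_strings n"
proof (cases "\<exists>i<n. b ! i \<and> \<not> c ! i")
  case True
  then obtain i where "i < n" "b ! i" "\<not> c ! i"
    by blast
  then show thesis
    using that[of i] clear_bit_fibonacci_strings[OF b, of i] by simp
next
  case False
  have len: "length b = n" "length c = n"
    using b c by (auto simp: fibonacci_strings_def)
  then obtain i where i: "i < n" "b ! i \<noteq> c ! i"
    using \<open>b \<noteq> c\<close> nth_equalityI[of b c] by auto
  have "b[i := c ! i] \<in> fibonacci_strings n"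
  proof (rule fibonacci_strings_mono[OF c])
    show "c ! j" if "j < n" "b[i := c ! i] ! j" for j
      using that len False by (cases "j = i") auto
  qed (simp add: len)
  with i show thesis
    by (rule that)
qed

lemma pverts_fibonacci_cube [simp]: "pverts (fibonacci_cube n) = fibonacci_strings n"
  by (simp add: fibonacci_cube_def)

lemma arc_fibonacci_cube_iff:
  "(b, c) \<in> parcs (fibonacci_cube n) \<longleftrightarrow>
    b \<in> fibonacci_strings n \<and> c \<in> fibonacci_strings n \<and> hamming n b c = 1"
  by (simp add: fibonacci_cube_def hamming_def)

lemma distance_fibonacci_cube:
  assumes "b \<in> fibonacci_strings n" "c \<in> fibonacci_strings n"
  shows "pair_graph.distance (fibonacci_cube n) b c = ereal (hamming n b c)"
proof -
  interpret pair_graph "fibonacci_cube n"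
    by (rule pair_graph_fibonacci_cube)
  show ?thesis
  proof (rule distance_eqI)
    fix x y
    assume "(x, y) \<in> parcs (fibonacci_cube n)"
    then show "hamming n x c \<le> Suc (hamming n y c)"
      using hamming_triangle[of n x c y] by (simp add: arc_fibonacci_cube_iff)
  next
    fix x
    assume x: "x \<in> pverts (fibonacci_cube n)" and "x \<noteq> c"
    then obtain i where i: "i < n" "x ! i \<noteq> c ! i" "x[i := c ! i] \<in> fibonacci_strings n"
      using fibonacci_strings_approach[of x n c] assms by auto
    moreover have "length x = n"
      using x by (simp add: fibonacci_strings_def)
    ultimately show "\<exists>y. (x, y) \<in> parcs (fibonacci_cube n) \<and> hamming n x c = Suc (hamming n y c)"
      using x hamming_fix_bit[of i n x c] hamming_flip_bit[of i n x "c ! i"]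
      by (intro exI[of _ "x[i := c ! i]"]) (auto simp: arc_fibonacci_cube_iff)
  qed (use assms in simp_all)
qed

text \<open>
  The strings \<open>u\<close> and \<open>u[i := False]\<close> differ only at position \<open>i\<close>, so only that bit of \<open>w\<close>
  decides which of them is nearer; a tie is impossible.
\<close>

lemma hamming_less_clear_bit_iff:
  assumes "i < n" "length u = n" "u ! i"
  shows "hamming n w u < hamming n w (u[i := False]) \<longleftrightarrow> w ! i"
    and "hamming n w (u[i := False]) < hamming n w u \<longleftrightarrow> \<not> w ! i"
proof -
  let ?u = "u[i := False]"
  have bits: "\<not> ?u ! i" "length ?u = n" "?u[i := True] = u"
    using assms by (simp_all, metis list_update_id)
  have *: "hamming n w ?u = Suc (hamming n w u)" if "w ! i"
    using hamming_fix_bit[of i n ?u w] bits assms that by (simp only: hamming_commute[of n w]) simp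
  have **: "hamming n w u = Suc (hamming n w ?u)" if "\<not> w ! i"
    using hamming_fix_bit[of i n u w] assms that by (simp only: hamming_commute[of n w]) simp
  show "hamming n w u < hamming n w ?u \<longleftrightarrow> w ! i"
    and "hamming n w ?u < hamming n w u \<longleftrightarrow> \<not> w ! i"
    using * ** by linarith+
qed

section \<open>Edges by direction\<close>

abbreviation strings_with_bit :: "nat \<Rightarrow> nat \<Rightarrow> bool \<Rightarrow> bool list set" where
  "strings_with_bit n i x \<equiv> {b \<in> fibonacci_strings n. b ! i = x}"

lemma closer_fibonacci_cube:
  assumes "i < n" "u \<in> fibonacci_strings n" "u ! i"
  shows "pair_graph.closer (fibonacci_cube n) u (u[i := False]) = card (strings_with_bit n i True)"
    and "pair_graph.closer (fibonacci_cube n) (u[i := False]) u = card (strings_with_bit n i False)"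
proof -
  interpret pair_graph "fibonacci_cube n"
    by (rule pair_graph_fibonacci_cube)
  have "length u = n"
    using assms by (simp add: fibonacci_strings_def)
  with assms clear_bit_fibonacci_strings[OF assms(2), of i]
  show "closer u (u[i := False]) = card (strings_with_bit n i True)"
    and "closer (u[i := False]) u = card (strings_with_bit n i False)"
    unfolding closer_def
    by (auto intro!: arg_cong[where f = card]
        simp: distance_fibonacci_cube hamming_less_clear_bit_iff)
qed

text \<open>
  Each edge is encoded by its direction and its end point with a 1 in that direction. This
  singles out one of the two end points, so that the sum over unordered edges becomes a sum over
  pairs.
\<close>

lemma bij_betw_edges_fibonacci_cube:
  "bij_betw (\<lambda>(i, u). {u[i := False], u}) (SIGMA i:{..<n}. strings_with_bit n i True)
    (pair_graph.edges (fibonacci_cube n))"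
proof -
  interpret pair_graph "fibonacci_cube n"
    by (rule pair_graph_fibonacci_cube)
  let ?A = "SIGMA i:{..<n}. strings_with_bit n i True"
  let ?f = "\<lambda>(i, u :: bool list). {u[i := False], u}"
  have inj: "i = j \<and> u = v"
    if "i < length u" "u ! i" "j < length v" "v ! j" "{u[i := False], u} = {v[j := False], v}"
    for i j and u v :: "bool list"
  proof -
    have *: "u[i := False] ! i \<noteq> u ! i" "v[j := False] ! j \<noteq> v ! j"
      "\<And>k. k \<noteq> j \<Longrightarrow> v[j := False] ! k = v ! k"
      using that by simp_all
    from that(5) have "u[i := False] = v[j := False] \<and> u = v \<or> u[i := False] = v \<and> u = v[j := False]"
      by (auto simp: doubleton_eq_iff)
    then show ?thesis
    proof
      assume "u[i := False] = v[j := False] \<and> u = v"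
      then show ?thesis
        using * by metis
    next
      \<comment> \<open>Impossible: each of the two strings would arise from the other by clearing a 1.\<close>
      assume **: "u[i := False] = v \<and> u = v[j := False]"
      then have "i = j"
        using * by metis
      then show ?thesis
        using ** that by auto
    qed
  qed
  have "inj_on ?f ?A"
    by (rule inj_onI) (auto simp: fibonacci_strings_def dest!: inj[rotated -1])
  moreover have "?f ` ?A = edges"
  proof (intro equalityI subsetI)
    fix e
    assume "e \<in> ?f ` ?A"
    then obtain i u where e: "i < n" "u \<in> fibonacci_strings n" "u ! i" "e = {u[i := False], u}"
      by auto
    from e have "hamming n u (u[i := False]) = 1"
      by (intro hamming_flip_bit) (auto simp: fibonacci_strings_def)
    with e have "(u, u[i := False]) \<in> parcs (fibonacci_cube n)"
      by (simp add: arc_fibonacci_cube_iff clear_bit_fibonacci_strings)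
    then show "e \<in> edges"
      unfolding edges_def using e(4) by blast
  next
    fix e
    assume "e \<in> edges"
    then obtain u v where e: "e = {u, v}" "u \<in> fibonacci_strings n" "v \<in> fibonacci_strings n"
      "hamming n u v = 1"
      by (auto simp: edges_def arc_fibonacci_cube_iff)
    then obtain i where "{i. i < n \<and> u ! i \<noteq> v ! i} = {i}"
      by (auto simp: hamming_def card_1_singleton_iff)
    then have i: "i < n" "u ! i \<noteq> v ! i" "\<And>j. j < n \<Longrightarrow> j \<noteq> i \<Longrightarrow> u ! j = v ! j"
      by auto
    have len: "length u = n" "length v = n"
      using e by (auto simp: fibonacci_strings_def)
    show "e \<in> ?f ` ?A"
    proof (cases "u ! i")
      case True
      then have "u[i := False] = v"
        using i len by (intro nth_equalityI) (auto simp: nth_list_update)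
      then show ?thesis
        using e i True by (intro image_eqI[of _ _ "(i, u)"]) auto
    next
      case False
      then have "v[i := False] = u"
        using i len by (intro nth_equalityI) (auto simp: nth_list_update)
      then show ?thesis
        using e i False by (intro image_eqI[of _ _ "(i, v)"]) auto
    qed
  qed
  ultimately show ?thesis
    by (simp add: bij_betw_def)
qed

section \<open>Counting Fibonacci strings\<close>

lemma Cons_Cons_fibonacci_strings:
  "x # y # b \<in> fibonacci_strings (Suc (Suc n)) \<longleftrightarrow>
    \<not> (x \<and> y) \<and> y # b \<in> fibonacci_strings (Suc n)"
  by (auto simp: fibonacci_strings_def nth_Cons' All_less_Suc2 gr0_conv_Suc)

lemma False_Cons_fibonacci_strings:
  "False # b \<in> fibonacci_strings (Suc n) \<longleftrightarrow> b \<in> fibonacci_strings n"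
  by (cases n; cases b) (auto simp: fibonacci_strings_def nth_Cons' All_less_Suc2 gr0_conv_Suc)

lemma card_fibonacci_strings: "card (fibonacci_strings n) = fib (n + 2)"
proof (induction n rule: fib.induct)
  case 1
  have "fibonacci_strings 0 = {[]}"
    by (auto simp: fibonacci_strings_def)
  then show ?case
    by simp
next
  case 2
  have "fibonacci_strings (Suc 0) = {[False], [True]}"
    by (auto simp: fibonacci_strings_def length_Suc_conv)
  then show ?case
    by (simp add: numeral_eq_Suc)
next
  case (3 n)
  let ?A = "(#) False ` fibonacci_strings (Suc n)"
  let ?B = "(\<lambda>b. True # False # b) ` fibonacci_strings n"
  have "fibonacci_strings (Suc (Suc n)) = ?A \<union> ?B"
  proof (intro equalityI subsetI)
    fix b
    assume b: "b \<in> fibonacci_strings (Suc (Suc n))"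
    then have "length b = Suc (Suc n)"
      by (simp add: fibonacci_strings_def)
    then obtain x y c where "b = x # y # c"
      by (auto simp: length_Suc_conv)
    with b show "b \<in> ?A \<union> ?B"
      by (cases x; cases y) (auto simp: Cons_Cons_fibonacci_strings False_Cons_fibonacci_strings)
  qed (auto simp: Cons_Cons_fibonacci_strings False_Cons_fibonacci_strings)
  moreover have "card (?A \<union> ?B) = card ?A + card ?B"
    by (intro card_Un_disjoint) (auto simp: finite_fibonacci_strings)
  moreover have "card ?A = fib (Suc n + 2)" "card ?B = fib (n + 2)"
    using 3 by (simp_all add: card_image inj_on_def)
  ultimately show ?case
    by simp
qed

text \<open>
  A 0 cannot take part in a pair of consecutive 1s, so the parts to its left and right do not
  constrain each other.
\<close>

lemma append_False_fibonacci_strings: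
  assumes "length b = m"
  shows "b @ False # c \<in> fibonacci_strings (Suc (m + k)) \<longleftrightarrow>
    b \<in> fibonacci_strings m \<and> c \<in> fibonacci_strings k"
  using assms
proof (induction b arbitrary: m)
  case Nil
  have "[] \<in> fibonacci_strings 0"
    by (simp add: fibonacci_strings_def)
  with Nil show ?case
    by (simp add: False_Cons_fibonacci_strings)
next
  case (Cons x b)
  show ?case
  proof (cases b)
    case Nil
    moreover have "[x] \<in> fibonacci_strings (Suc 0)"
      by (simp add: fibonacci_strings_def)
    ultimately show ?thesis
      using Cons.prems by (auto simp: Cons_Cons_fibonacci_strings False_Cons_fibonacci_strings)
  next
    case (Cons y d)
    then show ?thesis
      using Cons.IH[of "Suc (length d)"] Cons.prems by (auto simp: Cons_Cons_fibonacci_strings)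
  qed
qed

lemma card_strings_with_bit_False:
  assumes "i < n"
  shows "card (strings_with_bit n i False) = fib (i + 2) * fib (n - i + 1)"
proof -
  define k where "k = n - Suc i"
  have n: "n = Suc (i + k)"
    using assms by (simp add: k_def)
  let ?f = "\<lambda>(b, c). b @ False # c"
  have "bij_betw ?f (fibonacci_strings i \<times> fibonacci_strings k) (strings_with_bit n i False)"
    unfolding bij_betw_def
  proof
    show "inj_on ?f (fibonacci_strings i \<times> fibonacci_strings k)"
      by (auto simp: inj_on_def fibonacci_strings_def)
    show "?f ` (fibonacci_strings i \<times> fibonacci_strings k) = strings_with_bit n i False"
    proof (intro equalityI subsetI)
      fix d
      assume "d \<in> ?f ` (fibonacci_strings i \<times> fibonacci_strings k)"
      then obtain b c where "d = b @ False # c" "b \<in> fibonacci_strings i" "c \<in> fibonacci_strings k"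
        by auto
      moreover from this have "length b = i"
        by (simp add: fibonacci_strings_def)
      ultimately show "d \<in> strings_with_bit n i False"
        by (auto simp: n append_False_fibonacci_strings)
    next
      fix d
      assume d: "d \<in> strings_with_bit n i False"
      then have "length d = n"
        by (simp add: fibonacci_strings_def)
      then have "d = take i d @ False # drop (Suc i) d" "length (take i d) = i"
        using d assms id_take_nth_drop[of i d] by auto
      then show "d \<in> ?f ` (fibonacci_strings i \<times> fibonacci_strings k)"
        using d append_False_fibonacci_strings[of "take i d" i "drop (Suc i) d" k]
        by (intro image_eqI[of _ _ "(take i d, drop (Suc i) d)"]) (auto simp: n)
    qed
  qed
  then have "card (strings_with_bit n i False) = fib (i + 2) * fib (k + 2)"
    by (simp only: bij_betw_same_card[symmetric] card_cartesian_product card_fibonacci_strings)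
  then show ?thesis
    by (simp add: n)
qed

text \<open>
  Counting the complement avoids a decomposition around the bit 1, whose two neighbours are
  forced to be 0 but may be missing at the ends of the string.
\<close>

lemma card_strings_with_bit_True:
  assumes "i < n"
  shows "card (strings_with_bit n i True) = fib (i + 1) * fib (n - i)"
proof -
  have "fibonacci_strings n = strings_with_bit n i False \<union> strings_with_bit n i True"
    by auto
  then have "card (fibonacci_strings n) =
      card (strings_with_bit n i False) + card (strings_with_bit n i True)"
    by (subst card_Un_disjoint[symmetric]) (auto simp: finite_fibonacci_strings)
  moreover have "fib (n + 2) = fib (i + 2) * fib (n - i + 1) + fib (i + 1) * fib (n - i)"
    using fib_add[of "i + 1" "n - i"] assms by simp
  ultimately show ?thesis
    unfolding card_fibonacci_strings card_strings_with_bit_False[OF assms] by linarith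
qed

section \<open>The Mostar index\<close>

theorem theorem1:
  fixes n :: nat
  assumes "n \<ge> 1"
  shows "pair_graph.Mostar (fibonacci_cube n) =
    (\<Sum>k = 1..n. int (fib k) * int (fib (n - k + 1)) *
      (int (fib (k + 1)) * int (fib (n - k + 2)) - int (fib k) * int (fib (n - k + 1))))"
proof -
  interpret pair_graph "fibonacci_cube n"
    by (rule pair_graph_fibonacci_cube)
  define V where "V = strings_with_bit n"
  define D where "D i = int (card (V i False)) - int (card (V i True))" for i
  have imbalance: "edge_imbalance {u[i := False], u} = D i" if "i < n" "u \<in> V i True" for i u
  proof -
    \<comment> \<open>At each position a 0 is at least as frequent as a 1, which removes the absolute value.\<close>
    have "fib (i + 1) * fib (n - i) \<le> fib (i + 2) * fib (n - i + 1)"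
      by (intro mult_le_mono fib_mono) auto
    then have "card (V i True) \<le> card (V i False)"
      unfolding V_def using \<open>i < n\<close>
      by (simp only: card_strings_with_bit_False card_strings_with_bit_True)
    then show ?thesis
      using that unfolding D_def V_def edge_imbalance_pair
      by (simp add: closer_fibonacci_cube)
  qed
  have "Mostar = (\<Sum>(i, u)\<in>(SIGMA i:{..<n}. V i True). edge_imbalance {u[i := False], u})"
    unfolding Mostar_def V_def
    by (subst sum.reindex_bij_betw[OF bij_betw_edges_fibonacci_cube, symmetric])
      (simp add: case_prod_unfold)
  also have "\<dots> = (\<Sum>i<n. \<Sum>u\<in>V i True. edge_imbalance {u[i := False], u})"
    by (rule sum.Sigma[symmetric]) (auto simp: V_def finite_fibonacci_strings)
  also have "\<dots> = (\<Sum>i<n. int (card (V i True)) * D i)"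
    by (simp add: imbalance)
  also have "\<dots> = (\<Sum>k = 1..n. int (card (V (k - 1) True)) * D (k - 1))"
    by (rule sum.reindex_bij_witness[of _ "\<lambda>k. k - 1" Suc]) auto
  also have "\<dots> = (\<Sum>k = 1..n. int (fib k) * int (fib (n - k + 1)) *
      (int (fib (k + 1)) * int (fib (n - k + 2)) - int (fib k) * int (fib (n - k + 1))))"
  proof (rule sum.cong[OF refl])
    fix k
    assume k: "k \<in> {1..n}"
    then have "k - 1 < n" "k - 1 + 1 = k" "k - 1 + 2 = k + 1" "n - (k - 1) = n - k + 1"
        "n - (k - 1) + 1 = n - k + 2"
      by auto
    then show "int (card (V (k - 1) True)) * D (k - 1) = int (fib k) * int (fib (n - k + 1)) *
      (int (fib (k + 1)) * int (fib (n - k + 2)) - int (fib k) * int (fib (n - k + 1)))"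
      by (simp only: V_def D_def card_strings_with_bit_True card_strings_with_bit_False of_nat_mult)
  qed
  finally show ?thesis .
qed

end
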